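(* Let $T$ be a ternary $\Gamma$-semiring, let $f:M\to N$ be a morphism in $\mathsf{SMod}_{T,\Gamma}$ and let $\equiv_f$ be its kernel congruence. Then $M/{\equiv_f}\cong\mathrm{Im}(f)$ as ternary $\Gamma$-semimodules.
   Context: Fix a commutative monoid $(\Gamma,+,0_\Gamma)$. A ternary $\Gamma$-semiring is a commutative monoid $(T,+,0)$ with a map $T\times\Gamma\times T\times\Gamma\times T\to T$, $(a,\alpha,b,\beta,c)\mapsto a\alpha b\beta c$, that is additive in each of the five slots separately, satisfies ternary associativity $(a\alpha b\beta c)\gamma d\delta e=a\alpha(b\beta c\gamma d)\delta e=a\alpha b\beta(c\gamma d\delta e)$ for all $a,b,c,d,e\in T$, $\alpha,\beta,\gamma,\delta\in\Gamma$, and satisfies $a\alpha b\beta c=0$ whenever one of $a,b,c$ is $0$ or one of $\alpha,\beta$ is $0_\Gamma$. A ternary $\Gamma$-semimodule over $T$ is a commutative monoid $(M,+,0)$ with a map $T\times\Gamma\times M\times\Gamma\times T\to M$, $(a,\alpha,m,\beta,b)\mapsto a\alpha m\beta b$, that is additive in each of the five slots separately, satisfies $a\alpha m\beta b=0$ whenever $a=0$ or $m=0$ or $b=0$ or $\alpha=0_\Gamma$ or $\beta=0_\Gamma$, and satisfies $(a\alpha b\beta c)\gamma m\delta d=a\alpha(b\beta m\gamma c)\delta d$ for all $a,b,c,d\in T$, $m\in M$, $\alpha,\beta,\gamma,\delta\in\Gamma$. A morphism $f:M\to N$ is a monoid morphism with $f(a\alpha m\beta b)=a\alpha f(m)\beta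 b$ for all $a,b\in T$, $\alpha,\beta\in\Gamma$, $m\in M$. The resulting category is $\mathsf{SMod}_{T,\Gamma}$. A congruence on a semimodule $M$ is an equivalence relation $\equiv$ such that $x\equiv y$ implies $x+z\equiv y+z$ for all $z\in M$ and $a\alpha x\beta b\equiv a\alpha y\beta b$ for all $a,b\in T$, $\alpha,\beta\in\Gamma$. The quotient set $M/{\equiv}$ is a ternary $\Gamma$-semimodule with the operations induced from $M$. The kernel congruence of $f:M\to N$ is the congruence on $M$ given by $x\equiv_f y\iff f(x)=f(y)$. $\mathrm{Im}(f)=f(M)\subseteq N$ is the set-theoretic image, a subsemimodule of $N$ (a submonoid closed under all $n\mapsto a\alpha n\beta b$) with the induced structure. *)

theory Defs
  imports "HOL-Algebra.Group"
begin

text \<open>The underlying commutative monoids are \<open>comm_monoid\<close>s over the library's monoid records;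
  in this theory their operation and unit are displayed additively.\<close>

notation mult (infixl "\<oplus>\<index>" 65)
notation one ("\<zero>\<index>")

record ('t, 'g) ternary_ring = "'t monoid" +
  tmult :: "'t \<Rightarrow> 'g \<Rightarrow> 't \<Rightarrow> 'g \<Rightarrow> 't \<Rightarrow> 't"

record ('t, 'g, 'm) ternary_module = "'m monoid" +
  tact :: "'t \<Rightarrow> 'g \<Rightarrow> 'm \<Rightarrow> 'g \<Rightarrow> 't \<Rightarrow> 'm"

locale ternary_gamma_semiring = \<Gamma>: comm_monoid \<Gamma> + T: comm_monoid T
  for \<Gamma> :: "('g, 'x) monoid_scheme" and T :: "('t, 'g, 'y) ternary_ring_scheme" +
  assumes tmult_closed:
    "\<lbrakk>a \<in> carrier T; \<alpha> \<in> carrier \<Gamma>; b \<in> carrier T; \<beta> \<in> carrier \<Gamma>; c \<in> carrier T\<rbrakk>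
      \<Longrightarrow> tmult T a \<alpha> b \<beta> c \<in> carrier T"
  and tmult_add1:
    "\<lbrakk>a \<in> carrier T; a' \<in> carrier T; \<alpha> \<in> carrier \<Gamma>; b \<in> carrier T; \<beta> \<in> carrier \<Gamma>; c \<in> carrier T\<rbrakk>
      \<Longrightarrow> tmult T (a \<oplus>\<^bsub>T\<^esub> a') \<alpha> b \<beta> c = tmult T a \<alpha> b \<beta> c \<oplus>\<^bsub>T\<^esub> tmult T a' \<alpha> b \<beta> c"
  and tmult_add2:
    "\<lbrakk>a \<in> carrier T; \<alpha> \<in> carrier \<Gamma>; \<alpha>' \<in> carrier \<Gamma>; b \<in> carrier T; \<beta> \<in> carrier \<Gamma>; c \<in> carrier T\<rbrakk>
      \<Longrightarrow> tmult T a (\<alpha> \<oplus>\<^bsub>\<Gamma>\<^esub> \<alpha>') b \<beta> c = tmult T a \<alpha> b \<beta> c \<oplus>\<^bsub>T\<^esub> tmult T a \<alpha>' b \<beta> c"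
  and tmult_add3:
    "\<lbrakk>a \<in> carrier T; \<alpha> \<in> carrier \<Gamma>; b \<in> carrier T; b' \<in> carrier T; \<beta> \<in> carrier \<Gamma>; c \<in> carrier T\<rbrakk>
      \<Longrightarrow> tmult T a \<alpha> (b \<oplus>\<^bsub>T\<^esub> b') \<beta> c = tmult T a \<alpha> b \<beta> c \<oplus>\<^bsub>T\<^esub> tmult T a \<alpha> b' \<beta> c"
  and tmult_add4:
    "\<lbrakk>a \<in> carrier T; \<alpha> \<in> carrier \<Gamma>; b \<in> carrier T; \<beta> \<in> carrier \<Gamma>; \<beta>' \<in> carrier \<Gamma>; c \<in> carrier T\<rbrakk>
      \<Longrightarrow> tmult T a \<alpha> b (\<beta> \<oplus>\<^bsub>\<Gamma>\<^esub> \<beta>') c = tmult T a \<alpha> b \<beta> c \<oplus>\<^bsub>T\<^esub> tmult T a \<alpha> b \<beta>' c"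
  and tmult_add5:
    "\<lbrakk>a \<in> carrier T; \<alpha> \<in> carrier \<Gamma>; b \<in> carrier T; \<beta> \<in> carrier \<Gamma>; c \<in> carrier T; c' \<in> carrier T\<rbrakk>
      \<Longrightarrow> tmult T a \<alpha> b \<beta> (c \<oplus>\<^bsub>T\<^esub> c') = tmult T a \<alpha> b \<beta> c \<oplus>\<^bsub>T\<^esub> tmult T a \<alpha> b \<beta> c'"
  and tmult_assoc1:
    "\<lbrakk>a \<in> carrier T; b \<in> carrier T; c \<in> carrier T; d \<in> carrier T; e \<in> carrier T;
      \<alpha> \<in> carrier \<Gamma>; \<beta> \<in> carrier \<Gamma>; \<gamma> \<in> carrier \<Gamma>; \<delta> \<in> carrier \<Gamma>\<rbrakk>
      \<Longrightarrow> tmult T (tmult T a \<alpha> b \<beta> c) \<gamma> d \<delta> e = tmult T a \<alpha> (tmult T b \<beta> c \<gamma> d) \<delta> e"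
  and tmult_assoc2:
    "\<lbrakk>a \<in> carrier T; b \<in> carrier T; c \<in> carrier T; d \<in> carrier T; e \<in> carrier T;
      \<alpha> \<in> carrier \<Gamma>; \<beta> \<in> carrier \<Gamma>; \<gamma> \<in> carrier \<Gamma>; \<delta> \<in> carrier \<Gamma>\<rbrakk>
      \<Longrightarrow> tmult T a \<alpha> (tmult T b \<beta> c \<gamma> d) \<delta> e = tmult T a \<alpha> b \<beta> (tmult T c \<gamma> d \<delta> e)"
  and tmult_zero:
    "\<lbrakk>a \<in> carrier T; \<alpha> \<in> carrier \<Gamma>; b \<in> carrier T; \<beta> \<in> carrier \<Gamma>; c \<in> carrier T;
      a = \<zero>\<^bsub>T\<^esub> \<or> b = \<zero>\<^bsub>T\<^esub> \<or> c = \<zero>\<^bsub>T\<^esub> \<or> \<alpha> = \<zero>\<^bsub>\<Gamma>\<^esub> \<or> \<beta> = \<zero>\<^bsub>\<Gamma>\<^esub>\<rbrakk>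
      \<Longrightarrow> tmult T a \<alpha> b \<beta> c = \<zero>\<^bsub>T\<^esub>"

locale ternary_gamma_semimodule = ternary_gamma_semiring \<Gamma> T + M: comm_monoid M
  for \<Gamma> :: "('g, 'x) monoid_scheme" and T :: "('t, 'g, 'y) ternary_ring_scheme"
    and M :: "('t, 'g, 'm, 'z) ternary_module_scheme" +
  assumes tact_closed:
    "\<lbrakk>a \<in> carrier T; \<alpha> \<in> carrier \<Gamma>; m \<in> carrier M; \<beta> \<in> carrier \<Gamma>; b \<in> carrier T\<rbrakk>
      \<Longrightarrow> tact M a \<alpha> m \<beta> b \<in> carrier M"
  and tact_add1:
    "\<lbrakk>a \<in> carrier T; a' \<in> carrier T; \<alpha> \<in> carrier \<Gamma>; m \<in> carrier M; \<beta> \<in> carrier \<Gamma>; b \<in> carrier T\<rbrakk>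
      \<Longrightarrow> tact M (a \<oplus>\<^bsub>T\<^esub> a') \<alpha> m \<beta> b = tact M a \<alpha> m \<beta> b \<oplus>\<^bsub>M\<^esub> tact M a' \<alpha> m \<beta> b"
  and tact_add2:
    "\<lbrakk>a \<in> carrier T; \<alpha> \<in> carrier \<Gamma>; \<alpha>' \<in> carrier \<Gamma>; m \<in> carrier M; \<beta> \<in> carrier \<Gamma>; b \<in> carrier T\<rbrakk>
      \<Longrightarrow> tact M a (\<alpha> \<oplus>\<^bsub>\<Gamma>\<^esub> \<alpha>') m \<beta> b = tact M a \<alpha> m \<beta> b \<oplus>\<^bsub>M\<^esub> tact M a \<alpha>' m \<beta> b"
  and tact_add3:
    "\<lbrakk>a \<in> carrier T; \<alpha> \<in> carrier \<Gamma>; m \<in> carrier M; m' \<in> carrier M; \<beta> \<in> carrier \<Gamma>; b \<in> carrier T\<rbrakk>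
      \<Longrightarrow> tact M a \<alpha> (m \<oplus>\<^bsub>M\<^esub> m') \<beta> b = tact M a \<alpha> m \<beta> b \<oplus>\<^bsub>M\<^esub> tact M a \<alpha> m' \<beta> b"
  and tact_add4:
    "\<lbrakk>a \<in> carrier T; \<alpha> \<in> carrier \<Gamma>; m \<in> carrier M; \<beta> \<in> carrier \<Gamma>; \<beta>' \<in> carrier \<Gamma>; b \<in> carrier T\<rbrakk>
      \<Longrightarrow> tact M a \<alpha> m (\<beta> \<oplus>\<^bsub>\<Gamma>\<^esub> \<beta>') b = tact M a \<alpha> m \<beta> b \<oplus>\<^bsub>M\<^esub> tact M a \<alpha> m \<beta>' b"
  and tact_add5:
    "\<lbrakk>a \<in> carrier T; \<alpha> \<in> carrier \<Gamma>; m \<in> carrier M; \<beta> \<in> carrier \<Gamma>; b \<in> carrier T; b' \<in> carrier T\<rbrakk>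
      \<Longrightarrow> tact M a \<alpha> m \<beta> (b \<oplus>\<^bsub>T\<^esub> b') = tact M a \<alpha> m \<beta> b \<oplus>\<^bsub>M\<^esub> tact M a \<alpha> m \<beta> b'"
  and tact_zero:
    "\<lbrakk>a \<in> carrier T; \<alpha> \<in> carrier \<Gamma>; m \<in> carrier M; \<beta> \<in> carrier \<Gamma>; b \<in> carrier T;
      a = \<zero>\<^bsub>T\<^esub> \<or> m = \<zero>\<^bsub>M\<^esub> \<or> b = \<zero>\<^bsub>T\<^esub> \<or> \<alpha> = \<zero>\<^bsub>\<Gamma>\<^esub> \<or> \<beta> = \<zero>\<^bsub>\<Gamma>\<^esub>\<rbrakk>
      \<Longrightarrow> tact M a \<alpha> m \<beta> b = \<zero>\<^bsub>M\<^esub>"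
  and tact_assoc:
    "\<lbrakk>a \<in> carrier T; b \<in> carrier T; c \<in> carrier T; d \<in> carrier T; m \<in> carrier M;
      \<alpha> \<in> carrier \<Gamma>; \<beta> \<in> carrier \<Gamma>; \<gamma> \<in> carrier \<Gamma>; \<delta> \<in> carrier \<Gamma>\<rbrakk>
      \<Longrightarrow> tact M (tmult T a \<alpha> b \<beta> c) \<gamma> m \<delta> d = tact M a \<alpha> (tact M b \<beta> m \<gamma> c) \<delta> d"

text \<open>The library's \<open>hom\<close> only asks for preservation of the binary operation,
  so preservation of the zero is a separate condition.\<close>

locale ternary_gamma_morphism =
  M: ternary_gamma_semimodule \<Gamma> T M + N: ternary_gamma_semimodule \<Gamma> T N
  for \<Gamma> :: "('g, 'x) monoid_scheme" and T :: "('t, 'g, 'y) ternary_ring_scheme"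
    and M :: "('t, 'g, 'm, 'z) ternary_module_scheme"
    and N :: "('t, 'g, 'n, 'w) ternary_module_scheme" +
  fixes f :: "'m \<Rightarrow> 'n"
  assumes morph_hom: "f \<in> hom M N"
  and morph_zero: "f \<zero>\<^bsub>M\<^esub> = \<zero>\<^bsub>N\<^esub>"
  and morph_tact:
    "\<lbrakk>a \<in> carrier T; \<alpha> \<in> carrier \<Gamma>; m \<in> carrier M; \<beta> \<in> carrier \<Gamma>; b \<in> carrier T\<rbrakk>
      \<Longrightarrow> f (tact M a \<alpha> m \<beta> b) = tact N a \<alpha> (f m) \<beta> b"

text \<open>Isomorphism in the category of semimodules: a morphism with a two-sided inverse morphism.
  In particular both sides are semimodules.\<close>

definition semimodule_isomorphic ::
  "('g, 'x) monoid_scheme \<Rightarrow> ('t, 'g, 'y) ternary_ring_scheme \<Rightarrow>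
    ('t, 'g, 'm, 'z) ternary_module_scheme \<Rightarrow> ('t, 'g, 'n, 'w) ternary_module_scheme \<Rightarrow> bool"
  where
  "semimodule_isomorphic \<Gamma> T M N \<longleftrightarrow>
    (\<exists>\<phi> \<psi>. ternary_gamma_morphism \<Gamma> T M N \<phi> \<and> ternary_gamma_morphism \<Gamma> T N M \<psi> \<and>
      (\<forall>x \<in> carrier M. \<psi> (\<phi> x) = x) \<and> (\<forall>y \<in> carrier N. \<phi> (\<psi> y) = y))"

locale semimodule_congruence = ternary_gamma_semimodule \<Gamma> T M
  for \<Gamma> :: "('g, 'x) monoid_scheme" and T :: "('t, 'g, 'y) ternary_ring_scheme"
    and M :: "('t, 'g, 'm, 'z) ternary_module_scheme" +
  fixes r :: "('m \<times> 'm) set"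
  assumes cong_equiv: "equiv (carrier M) r"
  and cong_add: "\<lbrakk>(x, y) \<in> r; z \<in> carrier M\<rbrakk> \<Longrightarrow> (x \<oplus>\<^bsub>M\<^esub> z, y \<oplus>\<^bsub>M\<^esub> z) \<in> r"
  and cong_tact:
    "\<lbrakk>(x, y) \<in> r; a \<in> carrier T; \<alpha> \<in> carrier \<Gamma>; \<beta> \<in> carrier \<Gamma>; b \<in> carrier T\<rbrakk>
      \<Longrightarrow> (tact M a \<alpha> x \<beta> b, tact M a \<alpha> y \<beta> b) \<in> r"

text \<open>Each union below ranges over all representatives; for a congruence all its members
  coincide, see \<open>quotient_add\<close> and \<open>quotient_tact\<close>.\<close>

definition quotient_semimodule ::
  "('t, 'g, 'm, 'z) ternary_module_scheme \<Rightarrow> ('m \<times> 'm) set \<Rightarrow> ('t, 'g, 'm set) ternary_module"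
  where
  "quotient_semimodule M r =
    \<lparr>carrier = carrier M // r,
     mult = (\<lambda>X Y. \<Union>x \<in> X. \<Union>y \<in> Y. r `` {x \<oplus>\<^bsub>M\<^esub> y}),
     one = r `` {\<zero>\<^bsub>M\<^esub>},
     tact = (\<lambda>a \<alpha> X \<beta> b. \<Union>x \<in> X. r `` {tact M a \<alpha> x \<beta> b})\<rparr>"

definition kernel_congruence ::
  "('t, 'g, 'm, 'z) ternary_module_scheme \<Rightarrow> ('m \<Rightarrow> 'n) \<Rightarrow> ('m \<times> 'm) set" where
  "kernel_congruence M f = {(x, y). x \<in> carrier M \<and> y \<in> carrier M \<and> f x = f y}"

definition image_semimodule ::
  "('t, 'g, 'm, 'z) ternary_module_scheme \<Rightarrow> ('t, 'g, 'n, 'w) ternary_module_scheme \<Rightarrow>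
    ('m \<Rightarrow> 'n) \<Rightarrow> ('t, 'g, 'n, 'w) ternary_module_scheme" where
  "image_semimodule M N f = N\<lparr>carrier := f ` carrier M\<rparr>"

context semimodule_congruence
begin

lemma cong_carrier: "(x, y) \<in> r \<Longrightarrow> x \<in> carrier M \<and> y \<in> carrier M"
  using cong_equiv by (auto simp: equiv_def refl_on_def)

lemma quotient_add:
  assumes "x \<in> carrier M" "y \<in> carrier M"
  shows "r `` {x} \<oplus>\<^bsub>quotient_semimodule M r\<^esub> r `` {y} = r `` {x \<oplus>\<^bsub>M\<^esub> y}"
proof -
  have "congruent2 r r (\<lambda>x y. r `` {x \<oplus>\<^bsub>M\<^esub> y})"
  proof (rule congruent2_commuteI[OF cong_equiv])
    fix x y z assume "z \<in> carrier M" "(x, y) \<in> r"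
    then have "(x \<oplus>\<^bsub>M\<^esub> z, y \<oplus>\<^bsub>M\<^esub> z) \<in> r" by (rule cong_add[rotated])
    moreover have "x \<oplus>\<^bsub>M\<^esub> z = z \<oplus>\<^bsub>M\<^esub> x" "y \<oplus>\<^bsub>M\<^esub> z = z \<oplus>\<^bsub>M\<^esub> y"
      using \<open>z \<in> carrier M\<close> cong_carrier[OF \<open>(x, y) \<in> r\<close>] by (auto simp: M.m_comm)
    ultimately show "r `` {z \<oplus>\<^bsub>M\<^esub> x} = r `` {z \<oplus>\<^bsub>M\<^esub> y}"
      using equiv_class_eq[OF cong_equiv] by metis
  qed (simp add: M.m_comm)
  from UN_equiv_class2[OF cong_equiv cong_equiv this assms] show ?thesis
    by (simp add: quotient_semimodule_def)
qed

lemma quotient_tact: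
  assumes "a \<in> carrier T" "\<alpha> \<in> carrier \<Gamma>" "x \<in> carrier M" "\<beta> \<in> carrier \<Gamma>" "b \<in> carrier T"
  shows "tact (quotient_semimodule M r) a \<alpha> (r `` {x}) \<beta> b = r `` {tact M a \<alpha> x \<beta> b}"
proof -
  have "congruent r (\<lambda>x. r `` {tact M a \<alpha> x \<beta> b})"
    by (rule congruentI) (rule equiv_class_eq[OF cong_equiv cong_tact[OF _ assms(1,2,4,5)]])
  from UN_equiv_class[OF cong_equiv this assms(3)] show ?thesis
    by (simp add: quotient_semimodule_def)
qed

end

lemma (in ternary_gamma_morphism) kernel_congruence_is_congruence:
  "semimodule_congruence \<Gamma> T M (kernel_congruence M f)"
proof unfold_locales
  show "equiv (carrier M) (kernel_congruence M f)"
    by (auto simp: equiv_def refl_on_def sym_def trans_def kernel_congruence_def)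
qed (use morph_hom in \<open>auto simp: kernel_congruence_def hom_mult morph_tact M.tact_closed\<close>)

no_notation mult (infixl "\<oplus>\<index>" 65)
no_notation one ("\<zero>\<index>")

end

theory Submission imports Defs begin

text \<open>The map \<open>f\<close> takes a single value on each kernel class and different values
  on different classes. Sending a class to that value is therefore well defined and injective, and
  its range is exactly the image of \<open>f\<close>. The operations of the quotient are computed on
  representatives, so this induced map is a morphism (\<open>induced_morphism\<close>,
  \<open>bij_betw_induced\<close>), and a bijective morphism is an isomorphism because its inverse
  automatically respects the operations (\<open>bijective_imp_isomorphic\<close>). Morphisms are
  only defined between semimodules, so both ends must first be shown to be semimodules: the quotient
  by any congruence (\<open>quotient_semimodule\<close>) and the image, as a subsemimodule of
  \<open>N\<close> (\<open>image_semimodule\<close>).\<close>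

notation mult (infixl "\<oplus>\<index>" 65)
notation one ("\<zero>\<index>")

context semimodule_congruence
begin

text \<open>In this form every element of the quotient comes with a representative, so that
  \<open>quotient_add\<close> and \<open>quotient_tact\<close> can be used as rewrite rules.\<close>

lemma quotient_carrier: "carrier (quotient_semimodule M r) = (\<lambda>x. r `` {x}) ` carrier M"
  by (auto simp: quotient_semimodule_def quotient_def)

lemma quotient_one: "\<zero>\<^bsub>quotient_semimodule M r\<^esub> = r `` {\<zero>\<^bsub>M\<^esub>}"
  by (simp add: quotient_semimodule_def)

lemma quotient_comm_monoid: "comm_monoid (quotient_semimodule M r)"
proof (rule comm_monoidI)
  show "x \<oplus>\<^bsub>quotient_semimodule M r\<^esub> y \<oplus>\<^bsub>quotient_semimodule M r\<^esub> z =
      x \<oplus>\<^bsub>quotient_semimodule M r\<^esub> (y \<oplus>\<^bsub>quotient_semimodule M r\<^esub> z)"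
    if "x \<in> carrier (quotient_semimodule M r)" "y \<in> carrier (quotient_semimodule M r)"
      "z \<in> carrier (quotient_semimodule M r)" for x y z
    using that by (auto simp: quotient_carrier quotient_add M.m_assoc)
qed (auto simp: quotient_carrier quotient_one quotient_add M.m_comm)

text \<open>Once representatives are chosen, both sides of each axiom become classes of elements of
  \<open>M\<close> that the same axiom in \<open>M\<close> identifies.\<close>

lemma quotient_semimodule: "ternary_gamma_semimodule \<Gamma> T (quotient_semimodule M r)"
proof (intro ternary_gamma_semimodule.intro ternary_gamma_semimodule_axioms.intro
    ternary_gamma_semiring_axioms quotient_comm_monoid)
  note quotient_simps = quotient_carrier quotient_one quotient_add quotient_tact
  let ?Q = "quotient_semimodule M r"
  fix a \<alpha> X \<beta> b
  assume elems: "a \<in> carrier T" "\<alpha> \<in> carrier \<Gamma>" "X \<in> carrier ?Q" "\<beta> \<in> carrier \<Gamma>" "b \<in> carrier T"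
  obtain x where x: "x \<in> carrier M" "X = r `` {x}"
    using elems by (auto simp: quotient_carrier)
  show "tact ?Q a \<alpha> X \<beta> b \<in> carrier ?Q"
    using elems x by (auto simp: quotient_simps tact_closed)
  show "tact ?Q a \<alpha> X \<beta> b = \<zero>\<^bsub>?Q\<^esub>"
    if "a = \<zero>\<^bsub>T\<^esub> \<or> X = \<zero>\<^bsub>?Q\<^esub> \<or> b = \<zero>\<^bsub>T\<^esub> \<or> \<alpha> = \<zero>\<^bsub>\<Gamma>\<^esub> \<or> \<beta> = \<zero>\<^bsub>\<Gamma>\<^esub>"
  \<comment> \<open>If \<open>X\<close> is the zero class, its representative \<open>x\<close> may
    still be nonzero, so the zero of \<open>M\<close> must serve as representative instead.
    Otherwise one of the other four arguments vanishes and \<open>tact_zero\<close> applies to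
    \<open>x\<close> itself.\<close>
  proof (cases "X = \<zero>\<^bsub>?Q\<^esub>")
    case True
    then show ?thesis using elems by (simp add: quotient_one quotient_tact tact_zero)
  next
    case False
    then show ?thesis
      using elems x that tact_zero[of a \<alpha> x \<beta> b] by (auto simp: quotient_one quotient_tact)
  qed
  show "tact ?Q a \<alpha> (X \<oplus>\<^bsub>?Q\<^esub> Y) \<beta> b = tact ?Q a \<alpha> X \<beta> b \<oplus>\<^bsub>?Q\<^esub> tact ?Q a \<alpha> Y \<beta> b"
    if "Y \<in> carrier ?Q" for Y
    using elems x that by (auto simp: quotient_simps tact_closed tact_add3)
  show "tact ?Q (a \<oplus>\<^bsub>T\<^esub> a') \<alpha> X \<beta> b = tact ?Q a \<alpha> X \<beta> b \<oplus>\<^bsub>?Q\<^esub> tact ?Q a' \<alpha> X \<beta> b"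
    if "a' \<in> carrier T" for a'
    using elems x that by (simp add: quotient_simps tact_closed tact_add1)
  show "tact ?Q a \<alpha> X \<beta> (b \<oplus>\<^bsub>T\<^esub> b') = tact ?Q a \<alpha> X \<beta> b \<oplus>\<^bsub>?Q\<^esub> tact ?Q a \<alpha> X \<beta> b'"
    if "b' \<in> carrier T" for b'
    using elems x that by (simp add: quotient_simps tact_closed tact_add5)
  show "tact ?Q a (\<alpha> \<oplus>\<^bsub>\<Gamma>\<^esub> \<alpha>') X \<beta> b = tact ?Q a \<alpha> X \<beta> b \<oplus>\<^bsub>?Q\<^esub> tact ?Q a \<alpha>' X \<beta> b"
    if "\<alpha>' \<in> carrier \<Gamma>" for \<alpha>'
    using elems x that by (simp add: quotient_simps tact_closed tact_add2)
  show "tact ?Q a \<alpha> X (\<beta> \<oplus>\<^bsub>\<Gamma>\<^esub> \<beta>') b = tact ?Q a \<alpha> X \<beta> b \<oplus>\<^bsub>?Q\<^esub> tact ?Q a \<alpha> X \<beta>' b"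
    if "\<beta>' \<in> carrier \<Gamma>" for \<beta>'
    using elems x that by (simp add: quotient_simps tact_closed tact_add4)
next
  fix a b c d X \<alpha> \<beta> \<gamma> \<delta>
  assume "a \<in> carrier T" "b \<in> carrier T" "c \<in> carrier T" "d \<in> carrier T"
    "X \<in> carrier (quotient_semimodule M r)"
    "\<alpha> \<in> carrier \<Gamma>" "\<beta> \<in> carrier \<Gamma>" "\<gamma> \<in> carrier \<Gamma>" "\<delta> \<in> carrier \<Gamma>"
  then show "tact (quotient_semimodule M r) (tmult T a \<alpha> b \<beta> c) \<gamma> X \<delta> d =
    tact (quotient_semimodule M r) a \<alpha> (tact (quotient_semimodule M r) b \<beta> X \<gamma> c) \<delta> d"
    by (auto simp: quotient_carrier quotient_tact tact_closed tmult_closed tact_assoc)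
qed

end

text \<open>The remaining axioms are universally quantified equations, which restrict to any subset;
  only closure has to be assumed.\<close>

lemma (in ternary_gamma_semimodule) subsemimodule:
  assumes "submonoid H M"
    and tact_H: "\<And>a \<alpha> m \<beta> b. \<lbrakk>a \<in> carrier T; \<alpha> \<in> carrier \<Gamma>; m \<in> H; \<beta> \<in> carrier \<Gamma>; b \<in> carrier T\<rbrakk>
      \<Longrightarrow> tact M a \<alpha> m \<beta> b \<in> H"
  shows "ternary_gamma_semimodule \<Gamma> T (M\<lparr>carrier := H\<rparr>)"
proof -
  have H: "m \<in> carrier M" if "m \<in> H" for m
    using submonoid.subset[OF assms(1)] that by auto
  have "comm_monoid (M\<lparr>carrier := H\<rparr>)"
    using M.submonoid_is_comm_monoid[OF assms(1)] .
  then show ?thesis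
    by (intro ternary_gamma_semimodule.intro ternary_gamma_semimodule_axioms.intro
        ternary_gamma_semiring_axioms)
      (use H tact_H tact_zero in
        \<open>auto simp: tact_add1 tact_add2 tact_add3 tact_add4 tact_add5 tact_assoc\<close>)
qed

context ternary_gamma_morphism
begin

lemma morph_closed: "x \<in> carrier M \<Longrightarrow> f x \<in> carrier N"
  using morph_hom by (rule hom_in_carrier)

lemma morph_mult: "x \<in> carrier M \<Longrightarrow> y \<in> carrier M \<Longrightarrow> f (x \<oplus>\<^bsub>M\<^esub> y) = f x \<oplus>\<^bsub>N\<^esub> f y"
  using morph_hom by (rule hom_mult)

text \<open>Closure is seen by reading the morphism equations from right to left: zero, sums and
  actions formed from values of \<open>f\<close> are again values of \<open>f\<close>.\<close>

lemma image_semimodule: "ternary_gamma_semimodule \<Gamma> T (image_semimodule M N f)"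
  unfolding image_semimodule_def
proof (rule N.subsemimodule)
  show "submonoid (f ` carrier M) N"
    by (rule submonoid.intro)
      (auto simp: morph_closed morph_mult[symmetric] morph_zero[symmetric])
qed (auto simp: morph_tact[symmetric] M.tact_closed)

lemma bijective_imp_isomorphic:
  assumes bij: "bij_betw f (carrier M) (carrier N)"
  shows "semimodule_isomorphic \<Gamma> T M N"
proof -
  let ?g = "inv_into (carrier M) f"
  have g_closed: "?g y \<in> carrier M" and f_g: "f (?g y) = y" if "y \<in> carrier N" for y
    using bij that by (auto simp: bij_betw_def f_inv_into_f inv_into_into)
  have g_f: "?g (f x) = x" if "x \<in> carrier M" for x
    using bij that by (simp add: bij_betw_inv_into_left)
  have "ternary_gamma_morphism \<Gamma> T N M ?g"
  proof
    show "?g \<in> hom N M"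
    proof (rule homI)
      fix x y assume "x \<in> carrier N" "y \<in> carrier N"
      then show "?g (x \<oplus>\<^bsub>N\<^esub> y) = ?g x \<oplus>\<^bsub>M\<^esub> ?g y"
        \<comment> \<open>Both sides lie in \<open>carrier M\<close> and have the same image under
          \<open>f\<close>, namely the sum of \<open>x\<close> and \<open>y\<close>; applying
          \<open>?g\<close> to that image recovers the right-hand side. The zero and the action are
          handled in the same way.\<close>
        using g_f[of "?g x \<oplus>\<^bsub>M\<^esub> ?g y"] by (simp add: g_closed f_g morph_mult)
    qed (rule g_closed)
    show "?g \<zero>\<^bsub>N\<^esub> = \<zero>\<^bsub>M\<^esub>"
      using g_f[of "\<zero>\<^bsub>M\<^esub>"] by (simp add: morph_zero)
  next
    fix a \<alpha> m \<beta> b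
    assume "a \<in> carrier T" "\<alpha> \<in> carrier \<Gamma>" "m \<in> carrier N" "\<beta> \<in> carrier \<Gamma>" "b \<in> carrier T"
    then show "?g (tact N a \<alpha> m \<beta> b) = tact M a \<alpha> (?g m) \<beta> b"
      using g_f[of "tact M a \<alpha> (?g m) \<beta> b"] by (simp add: g_closed f_g morph_tact M.tact_closed)
  qed
  then show ?thesis
    unfolding semimodule_isomorphic_def
    using ternary_gamma_morphism_axioms g_f f_g by blast
qed

text \<open>The image of a kernel class is a singleton, so \<open>the_elem\<close> describes the
  induced map without choosing representatives.\<close>

lemma the_elem_image_kernel_class:
  assumes "x \<in> carrier M"
  shows "the_elem (f ` (kernel_congruence M f `` {x})) = f x"
proof -
  have "f ` (kernel_congruence M f `` {x}) = {f x}"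
    using assms by (auto simp: kernel_congruence_def)
  then show ?thesis by simp
qed

lemma induced_morphism:
  "ternary_gamma_morphism \<Gamma> T (quotient_semimodule M (kernel_congruence M f))
    (image_semimodule M N f) (\<lambda>X. the_elem (f ` X))"
proof -
  interpret K: semimodule_congruence \<Gamma> T M "kernel_congruence M f"
    by (rule kernel_congruence_is_congruence)
  note simps = K.quotient_carrier K.quotient_one K.quotient_add K.quotient_tact
    the_elem_image_kernel_class image_semimodule_def
  show ?thesis
    by (intro ternary_gamma_morphism.intro ternary_gamma_morphism_axioms.intro
        K.quotient_semimodule image_semimodule homI)
      (auto simp: simps morph_mult morph_zero morph_tact M.tact_closed)
qed

lemma bij_betw_induced:
  "bij_betw (\<lambda>X. the_elem (f ` X)) (carrier (quotient_semimodule M (kernel_congruence M f)))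
    (carrier (image_semimodule M N f))"
proof -
  interpret K: semimodule_congruence \<Gamma> T M "kernel_congruence M f"
    by (rule kernel_congruence_is_congruence)
  have "inj_on (\<lambda>X. the_elem (f ` X)) (carrier (quotient_semimodule M (kernel_congruence M f)))"
    unfolding K.quotient_carrier
    \<comment> \<open>Equality of the induced values means \<open>f x = f y\<close> for
      representatives; unfolding the kernel then shows that the two classes have the same
      members.\<close>
    by (rule inj_onI) (auto simp: the_elem_image_kernel_class, auto simp: kernel_congruence_def)
  then show ?thesis
    by (simp add: bij_betw_def K.quotient_carrier image_semimodule_def image_image
        the_elem_image_kernel_class)
qed

end

theorem theorem6p1:
  fixes \<Gamma> :: "('g, 'x) monoid_scheme"
    and T :: "('t, 'g, 'y) ternary_ring_scheme"
    and M :: "('t, 'g, 'm, 'z) ternary_module_scheme"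
    and N :: "('t, 'g, 'n, 'w) ternary_module_scheme"
    and f :: "'m \<Rightarrow> 'n"
  assumes "ternary_gamma_semiring \<Gamma> T"
    and "ternary_gamma_morphism \<Gamma> T M N f"
  shows "semimodule_isomorphic \<Gamma> T
    (quotient_semimodule M (kernel_congruence M f)) (image_semimodule M N f)"
proof -
  interpret ternary_gamma_morphism \<Gamma> T M N f by (rule assms(2))
  show ?thesis
    \<comment> \<open>The locale lemma is applied to the induced map in place of
      \<open>f\<close>.\<close>
    by (rule ternary_gamma_morphism.bijective_imp_isomorphic[OF induced_morphism bij_betw_induced])
qed

end
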